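(* Let $r\geq 2$, let $k$ be a positive integer, and let $H$ be a fixed graph with chromatic number $\chi(H)=r+1$. Then, as $n\to\infty$, $$ex_\phi(n,H)=ex_\phi(n,K_{r+1})+o(n^{k+1}).$$
   Context: All graphs are finite, simple and undirected. For a positive integer $k$ and a graph $G$ with degree sequence $d_1,\ldots,d_n$, define $e_\phi(G)=\sum_{i=1}^n\binom{d_i}{k}$. For a graph $H$, $ex_\phi(n,H)$ denotes the maximum of $e_\phi(G)$ over all graphs $G$ on $n$ vertices that do not contain $H$ as a subgraph. $K_{r+1}$ is the complete graph on $r+1$ vertices. *)

theory Defs
  imports "Graph_Theory.Graph_Theory" "HOL-Library.Landau_Symbols"
begin

text \<open>
  A finite simple undirected graph is a \<open>pair_graph\<close>: an undirected edge \<open>uv\<close> is represented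
  by the two arcs \<open>(u, v)\<close> and \<open>(v, u)\<close>, so that the degree of a vertex is its out-degree.
\<close>

definition e_phi :: "nat \<Rightarrow> 'a pair_pre_digraph \<Rightarrow> nat" where
  "e_phi k G = (\<Sum>v\<in>pverts G. out_degree (with_proj G) v choose k)"

text \<open>Not necessarily induced subgraphs, up to isomorphism.\<close>

definition contains_graph :: "'a pair_pre_digraph \<Rightarrow> 'b pair_pre_digraph \<Rightarrow> bool" where
  "contains_graph G H \<longleftrightarrow>
     (\<exists>f. inj_on f (pverts H) \<and> f ` pverts H \<subseteq> pverts G \<and>
          (\<forall>(u, v)\<in>parcs H. (f u, f v) \<in> parcs G))"

definition proper_colouring :: "nat \<Rightarrow> 'a pair_pre_digraph \<Rightarrow> ('a \<Rightarrow> nat) \<Rightarrow> bool" where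
  "proper_colouring m G c \<longleftrightarrow>
     c ` pverts G \<subseteq> {..<m} \<and> (\<forall>(u, v)\<in>parcs G. c u \<noteq> c v)"

definition chromatic_number :: "'a pair_pre_digraph \<Rightarrow> nat" where
  "chromatic_number G = (LEAST m. \<exists>c. proper_colouring m G c)"

definition complete_graph :: "nat \<Rightarrow> nat pair_pre_digraph" where
  "complete_graph m =
     \<lparr>pverts = {..<m}, parcs = {(u, v). u < m \<and> v < m \<and> u \<noteq> v}\<rparr>"

definition free_graphs :: "nat \<Rightarrow> 'a pair_pre_digraph \<Rightarrow> nat pair_pre_digraph set" where
  "free_graphs n H = {G. pair_graph G \<and> card (pverts G) = n \<and> \<not> contains_graph G H}"

text \<open>
  Every finite graph is isomorphic to one whose vertices are natural numbers, so it suffices to let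
  \<open>G\<close> range over those. The maximum is over a finite set, which is nonempty as soon as \<open>H\<close> has
  an edge (see \<open>finite_e_phi_free_graphs\<close> and \<open>free_graphs_nonempty\<close>); otherwise
  \<open>Max {}\<close> is unspecified.
\<close>

definition ex_phi :: "nat \<Rightarrow> nat \<Rightarrow> 'a pair_pre_digraph \<Rightarrow> nat" where
  "ex_phi k n H = Max (e_phi k ` free_graphs n H)"

lemma complete_graph_is_complete: "K\<^bsub>m\<^esub> (with_proj (complete_graph m))"
  by (auto simp: complete_digraph_pair_def complete_graph_def)

lemma out_degree_pair:
  "out_degree (with_proj G) v = card {w. (v, w) \<in> parcs G}"
proof -
  have "out_arcs (with_proj G) v = Pair v ` {w. (v, w) \<in> parcs G}"
    by (auto simp: out_arcs_def)
  then show ?thesis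
    by (simp add: out_degree_def card_image inj_on_def)
qed

lemma out_degree_le_card:
  assumes "pair_graph G"
  shows "out_degree (with_proj G) v \<le> card (pverts G)"
proof -
  interpret pair_graph G by fact
  have "{w. (v, w) \<in> parcs G} \<subseteq> pverts G"
    using arc_snd_in_verts by fastforce
  then show ?thesis
    by (simp add: out_degree_pair card_mono)
qed

lemma finite_e_phi_free_graphs: "finite (e_phi k ` free_graphs n H)"
proof (rule finite_subset)
  have "e_phi k G \<le> n * (n choose k)" if "G \<in> free_graphs n H" for G
  proof -
    from that have G: "pair_graph G" and n: "card (pverts G) = n"
      by (auto simp: free_graphs_def)
    have "e_phi k G \<le> (\<Sum>v\<in>pverts G. n choose k)"
      unfolding e_phi_def
      by (intro sum_mono binomial_right_mono) (metis out_degree_le_card[OF G] n)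
    then show ?thesis
      using n by simp
  qed
  then show "e_phi k ` free_graphs n H \<subseteq> {..n * (n choose k)}"
    by auto
qed simp

lemma free_graphs_nonempty:
  assumes "parcs H \<noteq> {}"
  shows "free_graphs n H \<noteq> {}"
proof -
  let ?G = "\<lparr>pverts = {..<n}, parcs = {}\<rparr> :: nat pair_pre_digraph"
  have "pair_graph ?G"
    by unfold_locales (auto simp: symmetric_def sym_def arcs_ends_def)
  then have "?G \<in> free_graphs n H"
    using assms by (auto simp: free_graphs_def contains_graph_def)
  then show ?thesis by blast
qed

end

theory Submission
  imports Defs "HOL-Library.FuncSet"
begin

text \<open>
  \<^const>\<open>e_phi\<close> counts stars with \<open>k\<close> leaves, so averaging over the induced subgraphs on \<open>m\<close> vertices
  shows that the maximal star density \<open>ex_phi k n F / (n choose (k + 1))\<close> is decreasing in \<open>n\<close>; for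
  \<open>F = K\<^sub>r\<^sub>+\<^sub>1\<close> call its infimum \<open>d\<close>. If the star density of \<open>G\<close> exceeds \<open>d + \<epsilon>\<close>, the same averaging gives a
  positive proportion of \<open>m\<close>-sets that contain \<open>F\<close>, and then a pigeonhole argument
  yields a copy of \<open>F\<close> with one vertex cloned any fixed number of times. Hence cloning a vertex does
  not increase the asymptotic density, and cloning the vertices of \<open>K\<^sub>r\<^sub>+\<^sub>1\<close> one after the other
  reaches a complete \<open>(r + 1)\<close>-partite graph containing \<open>H\<close>. Conversely, every \<open>K\<^sub>r\<^sub>+\<^sub>1\<close>-free graph is
  dominated degree by degree by an \<open>r\<close>-partite graph, which is \<open>H\<close>-free.
\<close>

section \<open>Counting supersets, and consecutive binomial coefficients\<close>

text \<open>Removing \<open>B\<close> is a bijection onto the subsets of \<open>V - B\<close> of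
  size \<open>m - card B\<close>. It is applied with \<open>B\<close> the vertex set of a
  star.\<close>

lemma card_supersets:
  assumes "finite V" "B \<subseteq> V" "card B \<le> m"
  shows "card {S. B \<subseteq> S \<and> S \<subseteq> V \<and> card S = m} = (card V - card B) choose (m - card B)"
proof -
  have B: "finite B" using assms finite_subset by blast
  have "bij_betw (\<lambda>T. T \<union> B) {T. T \<subseteq> V - B \<and> card T = m - card B}
          {S. B \<subseteq> S \<and> S \<subseteq> V \<and> card S = m}"
  proof (rule bij_betw_byWitness[where f' = "\<lambda>S. S - B"])
    show "(\<lambda>T. T \<union> B) ` {T. T \<subseteq> V - B \<and> card T = m - card B}
            \<subseteq> {S. B \<subseteq> S \<and> S \<subseteq> V \<and> card S = m}"
    proof clarsimp
      fix T assume T: "T \<subseteq> V - B" "card T = m - card B"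
      then have "finite T" using assms(1) by (meson finite_Diff finite_subset)
      then have "card (T \<union> B) = card T + card B"
        using T B by (intro card_Un_disjoint) auto
      then show "T \<subseteq> V \<and> B \<subseteq> V \<and> card (T \<union> B) = m"
        using T assms by auto
    qed
  qed (use assms B in \<open>auto simp: card_Diff_subset\<close>)
  then have "card {S. B \<subseteq> S \<and> S \<subseteq> V \<and> card S = m}
               = card {T. T \<subseteq> V - B \<and> card T = m - card B}"
    by (simp add: bij_betw_same_card)
  also have "\<dots> = (card V - card B) choose (m - card B)"
    using assms B by (subst n_subsets) (auto simp: card_Diff_subset)
  finally show ?thesis .
qed

text \<open>For fixed \<open>m\<close>, \<open>n choose m\<close> outgrows
  \<open>n choose (m - 1)\<close> by a factor linear in \<open>n\<close>; this lets a positive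
  proportion of \<open>m\<close>-sets exceed the pigeonhole threshold. The difference is real, so
  not truncated; for \<open>n < m - 1\<close> both binomials vanish.\<close>

lemma binomial_pred_times:
  assumes "0 < m"
  shows "real (n choose m) * m = real (n choose (m - 1)) * (real n - real (m - 1))"
proof -
  obtain j where j: "m = Suc j" using assms by (cases m) auto
  show ?thesis
  proof (cases "j \<le> n")
    case True
    have "(n choose Suc j) * Suc j = (n choose j) * (n - j)"
      using binomial_absorb_comp[of n j] times_binomial_minus1_eq[of "Suc j" n] True
      by (simp add: mult.commute)
    then have "real ((n choose Suc j) * Suc j) = real ((n choose j) * (n - j))" by (simp only:)
    then show ?thesis unfolding j of_nat_mult using True by (simp add: of_nat_diff)
  qed (use j in \<open>simp add: binomial_eq_0\<close>)
qed

section \<open>Graph inclusions\<close>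

definition induced :: "'a pair_pre_digraph \<Rightarrow> 'a set \<Rightarrow> 'a pair_pre_digraph" where
  "induced G S = \<lparr>pverts = S, parcs = parcs G \<inter> S \<times> S\<rparr>"

lemma induced_simps [simp]:
  "pverts (induced G S) = S" "parcs (induced G S) = parcs G \<inter> S \<times> S"
  by (auto simp: induced_def)

lemma pair_graphI:
  assumes "finite (pverts G)" "parcs G \<subseteq> pverts G \<times> pverts G"
    and "\<And>u v. (u, v) \<in> parcs G \<Longrightarrow> (v, u) \<in> parcs G" "\<And>v. (v, v) \<notin> parcs G"
  shows "pair_graph G"
proof -
  have "finite (parcs G)" using assms(1,2) finite_subset by blast
  then show ?thesis
    using assms by unfold_locales (auto simp: symmetric_def sym_def)
qed

lemma pair_graphD:
  assumes "pair_graph G"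
  shows "finite (pverts G)" "parcs G \<subseteq> pverts G \<times> pverts G"
    "(u, v) \<in> parcs G \<Longrightarrow> (v, u) \<in> parcs G" "(v, v) \<notin> parcs G"
proof -
  interpret pair_graph G by fact
  show "finite (pverts G)" by (fact pair_finite_verts)
  show "parcs G \<subseteq> pverts G \<times> pverts G" using wellformed' by auto
  show "(u, v) \<in> parcs G \<Longrightarrow> (v, u) \<in> parcs G" by (rule arcs_symmetric)
  show "(v, v) \<notin> parcs G" using pair_no_loops[of "(v, v)"] by auto
qed

lemma pair_graph_induced:
  assumes "pair_graph G" "S \<subseteq> pverts G"
  shows "pair_graph (induced G S)"
  using pair_graphD[OF assms(1)] assms(2)
  by (intro pair_graphI) (auto intro: finite_subset)

lemma contains_graphE:
  assumes "contains_graph G H"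
  obtains f where "inj_on f (pverts H)" "f ` pverts H \<subseteq> pverts G"
    "\<And>u v. (u, v) \<in> parcs H \<Longrightarrow> (f u, f v) \<in> parcs G"
proof -
  from assms obtain f where f: "inj_on f (pverts H)" "f ` pverts H \<subseteq> pverts G"
      "\<forall>(u, v)\<in>parcs H. (f u, f v) \<in> parcs G"
    unfolding contains_graph_def by blast
  show thesis by (rule that[OF f(1,2)]) (use f(3) in blast)
qed

lemma contains_graphI:
  assumes "inj_on f (pverts H)" "f ` pverts H \<subseteq> pverts G"
    and "\<And>u v. (u, v) \<in> parcs H \<Longrightarrow> (f u, f v) \<in> parcs G"
  shows "contains_graph G H"
  unfolding contains_graph_def using assms by (intro exI[of _ f] conjI) auto

lemma contains_graph_trans:
  assumes "contains_graph F G" "contains_graph G H"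
  shows "contains_graph F H"
proof -
  obtain f where f: "inj_on f (pverts G)" "f ` pverts G \<subseteq> pverts F"
      "\<And>u v. (u, v) \<in> parcs G \<Longrightarrow> (f u, f v) \<in> parcs F"
    by (rule contains_graphE[OF assms(1)]) blast
  obtain g where g: "inj_on g (pverts H)" "g ` pverts H \<subseteq> pverts G"
      "\<And>u v. (u, v) \<in> parcs H \<Longrightarrow> (g u, g v) \<in> parcs G"
    by (rule contains_graphE[OF assms(2)]) blast
  show ?thesis
  proof (rule contains_graphI)
    show "inj_on (f \<circ> g) (pverts H)"
      by (rule comp_inj_on[OF g(1) inj_on_subset[OF f(1) g(2)]])
    show "(f \<circ> g) ` pverts H \<subseteq> pverts F"
      using f(2) g(2) by (simp add: image_subset_iff)
    show "((f \<circ> g) u, (f \<circ> g) v) \<in> parcs F" if "(u, v) \<in> parcs H" for u v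
      using f(3)[OF g(3)[OF that]] by simp
  qed
qed

lemma contains_graph_induced: "S \<subseteq> pverts G \<Longrightarrow> contains_graph G (induced G S)"
  by (rule contains_graphI[of id]) auto

section \<open>Averaging over vertex subsets\<close>

text \<open>A star is a centre with its leaf set, so for \<open>k = 1\<close> an edge counts twice,
  as in the degree sum.\<close>

definition stars :: "nat \<Rightarrow> 'a pair_pre_digraph \<Rightarrow> ('a \<times> 'a set) set" where
  "stars k G = (SIGMA v:pverts G. {A. A \<subseteq> {w. (v, w) \<in> parcs G} \<and> card A = k})"

lemma finite_neighbours:
  assumes "pair_graph G"
  shows "finite {w. (v, w) \<in> parcs G}"
  using pair_graphD[OF assms] by (auto intro: finite_subset[of _ "pverts G"])

lemma finite_stars: "pair_graph G \<Longrightarrow> finite (stars k G)"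
  unfolding stars_def
  by (intro finite_SigmaI) (auto simp: pair_graphD(1) finite_neighbours)

lemma card_stars: "pair_graph G \<Longrightarrow> card (stars k G) = e_phi k G"
  unfolding stars_def e_phi_def
  by (subst card_SigmaI) (auto simp: pair_graphD(1) finite_neighbours n_subsets out_degree_pair)

lemma stars_induced:
  assumes "S \<subseteq> pverts G"
  shows "stars k (induced G S) = {(v, A) \<in> stars k G. insert v A \<subseteq> S}"
  using assms by (auto simp: stars_def)

text \<open>Double counting of pairs of a star and an \<open>m\<close>-set containing it.\<close>

lemma sum_e_phi_induced:
  assumes G: "pair_graph G" and m: "k + 1 \<le> m"
  shows "(\<Sum>S | S \<subseteq> pverts G \<and> card S = m. e_phi k (induced G S))
           = e_phi k G * ((card (pverts G) - (k + 1)) choose (m - (k + 1)))"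
proof -
  let ?V = "pverts G"
  let ?M = "{S. S \<subseteq> ?V \<and> card S = m}"
  note GD = pair_graphD[OF G]
  have M: "finite ?M" using GD(1) by auto
  have "(\<Sum>S\<in>?M. e_phi k (induced G S))
          = (\<Sum>S\<in>?M. \<Sum>s | s \<in> stars k G \<and> insert (fst s) (snd s) \<subseteq> S. 1)"
  proof (intro sum.cong refl)
    fix S assume S: "S \<in> ?M"
    then have "e_phi k (induced G S) = card (stars k (induced G S))"
      using card_stars pair_graph_induced[OF G] by (metis (lifting) mem_Collect_eq)
    then show "e_phi k (induced G S)
                 = (\<Sum>s | s \<in> stars k G \<and> insert (fst s) (snd s) \<subseteq> S. 1)"
      using S by (simp add: stars_induced case_prod_unfold)
  qed
  also have "\<dots> = (\<Sum>s\<in>stars k G. \<Sum>S | S \<in> ?M \<and> insert (fst s) (snd s) \<subseteq> S. 1)"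
    by (rule sum.swap_restrict[OF M finite_stars[OF G]])
  also have "\<dots> = (\<Sum>s\<in>stars k G. (card ?V - (k + 1)) choose (m - (k + 1)))"
  proof (intro sum.cong refl)
    fix s assume s: "s \<in> stars k G"
    obtain v A where [simp]: "s = (v, A)" by (cases s)
    have A: "v \<in> ?V" "A \<subseteq> {w. (v, w) \<in> parcs G}" "card A = k"
      using s by (auto simp: stars_def)
    have "finite A" using A(2) finite_neighbours[OF G] finite_subset by blast
    \<comment> \<open>Without loops the centre is not a leaf, so a star spans exactly
      \<open>k + 1\<close> vertices.\<close>
    moreover have "v \<notin> A" using A(2) GD(4) by auto
    ultimately have c: "card (insert v A) = k + 1" using A(3) by simp
    have "insert v A \<subseteq> ?V" using A(1,2) GD(2) by auto
    from card_supersets[OF GD(1) this, of m]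
    have "card {S. insert v A \<subseteq> S \<and> S \<subseteq> ?V \<and> card S = m}
            = (card ?V - (k + 1)) choose (m - (k + 1))"
      unfolding c using m by simp
    moreover have "{S. S \<in> ?M \<and> insert (fst s) (snd s) \<subseteq> S}
                     = {S. insert v A \<subseteq> S \<and> S \<subseteq> ?V \<and> card S = m}" by auto
    ultimately show "(\<Sum>S | S \<in> ?M \<and> insert (fst s) (snd s) \<subseteq> S. 1)
                       = (card ?V - (k + 1)) choose (m - (k + 1))" by simp
  qed
  finally show ?thesis by (simp add: card_stars[OF G])
qed

lemma e_phi_le_choose:
  assumes "pair_graph G"
  shows "e_phi k G \<le> card (pverts G) * (card (pverts G) choose k)"
proof -
  have "e_phi k G \<le> (\<Sum>v\<in>pverts G. card (pverts G) choose k)"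
    unfolding e_phi_def by (intro sum_mono binomial_right_mono out_degree_le_card assms)
  then show ?thesis by simp
qed

lemma e_phi_le_ex_phi: "G \<in> free_graphs n H \<Longrightarrow> e_phi k G \<le> ex_phi k n H"
  unfolding ex_phi_def by (intro Max_ge finite_e_phi_free_graphs) auto

lemma induced_free:
  assumes "G \<in> free_graphs n F" "S \<subseteq> pverts G" "card S = m"
  shows "induced G S \<in> free_graphs m F"
  using assms contains_graph_trans[OF contains_graph_induced[OF assms(2)]]
  by (auto simp: free_graphs_def pair_graph_induced)

text \<open>Induced subgraphs on \<open>m\<close> vertices are again \<open>F\<close>-free, so the
  average star count over \<open>m\<close>-sets is at most \<open>ex_phi k m F\<close>;
  \<open>choose_mult\<close> turns this into a comparison of densities.\<close>

lemma e_phi_le_density: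
  assumes "G \<in> free_graphs n F" "k + 1 \<le> m" "m \<le> n"
  shows "real (e_phi k G) \<le> real (ex_phi k m F) / (m choose (k + 1)) * (n choose (k + 1))"
proof -
  let ?M = "{S. S \<subseteq> pverts G \<and> card S = m}"
  have G: "pair_graph G" and n: "card (pverts G) = n" using assms by (auto simp: free_graphs_def)
  have cM: "card ?M = n choose m" using n_subsets[OF pair_graphD(1)[OF G]] n by simp
  have pos: "0 < m choose (k + 1)" "0 < (n - (k + 1)) choose (m - (k + 1))"
    using assms by (auto simp: zero_less_binomial_iff)
  have "e_phi k G * ((n - (k + 1)) choose (m - (k + 1))) = (\<Sum>S\<in>?M. e_phi k (induced G S))"
    using sum_e_phi_induced[OF G assms(2)] n by simp
  also have "\<dots> \<le> (\<Sum>S\<in>?M. ex_phi k m F)"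
    by (intro sum_mono e_phi_le_ex_phi) (use induced_free[OF assms(1)] in auto)
  also have "\<dots> = (n choose m) * ex_phi k m F" by (simp add: cM)
  finally have "e_phi k G * ((n - (k + 1)) choose (m - (k + 1))) * (m choose (k + 1))
                  \<le> ex_phi k m F * ((n choose m) * (m choose (k + 1)))"
    by (simp add: algebra_simps)
  also have "\<dots> = ex_phi k m F * (n choose (k + 1)) * ((n - (k + 1)) choose (m - (k + 1)))"
    using choose_mult[OF assms(2,3)] by simp
  finally have "e_phi k G * (m choose (k + 1)) \<le> ex_phi k m F * (n choose (k + 1))"
    using pos by (simp add: algebra_simps)
  then have "real (e_phi k G) * real (m choose (k + 1))
               \<le> real (ex_phi k m F) * real (n choose (k + 1))"
    by (metis of_nat_le_iff of_nat_mult)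
  then show ?thesis using pos by (simp add: field_simps)
qed

section \<open>Blowing up a vertex\<close>

text \<open>The clones are the vertices that \<open>p\<close> sends to \<open>x\<close>; they are
  pairwise non-adjacent because \<open>x\<close> has no loop. As \<open>p\<close> only has to
  preserve arcs, \<open>F'\<close> may be any subgraph of the full blow-up, even one with no
  clone.\<close>

definition vertex_blowup ::
    "('b \<Rightarrow> 'a) \<Rightarrow> 'a \<Rightarrow> 'a pair_pre_digraph \<Rightarrow> 'b pair_pre_digraph \<Rightarrow> bool" where
  "vertex_blowup p x F F' \<longleftrightarrow>
     finite (pverts F) \<and> finite (pverts F') \<and> x \<in> pverts F \<and> (x, x) \<notin> parcs F \<and>
     parcs F' \<subseteq> pverts F' \<times> pverts F' \<and> p ` pverts F' \<subseteq> pverts F \<and>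
     inj_on p {u \<in> pverts F'. p u \<noteq> x} \<and> (\<forall>(u, v)\<in>parcs F'. (p u, p v) \<in> parcs F)"

text \<open>Pigeonhole on the pairs \<open>(S - {f x}, f restricted to F - x)\<close>, where \<open>f\<close> embeds \<open>F\<close> into the
  \<open>m\<close>-set \<open>S\<close>: sets \<open>S\<close> with the same pair differ only in the image of \<open>x\<close>, so these images are the
  clones of \<open>x\<close> in a copy of \<open>F'\<close>.\<close>

lemma contains_vertex_blowup:
  assumes bl: "vertex_blowup p x F F'" and fin: "finite (pverts G)"
    and m: "0 < m"
    and many: "card {S. S \<subseteq> pverts G \<and> card S = m \<and> contains_graph (induced G S) F}
       > card (pverts F') * ((card (pverts G) choose (m - 1)) * (m - 1) ^ card (pverts F - {x}))"
  shows "contains_graph G F'"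
proof -
  let ?M = "{S. S \<subseteq> pverts G \<and> card S = m \<and> contains_graph (induced G S) F}"
  let ?R = "pverts F - {x}"
  \<comment> \<open>The range of the keys; its size is the threshold in \<open>many\<close> without
    the factor \<open>card (pverts F')\<close>.\<close>
  define K where "K = (SIGMA T:{T. T \<subseteq> pverts G \<and> card T = m - 1}. ?R \<rightarrow>\<^sub>E T)"
  have finF: "finite (pverts F)" "finite (pverts F')" and x: "x \<in> pverts F" "(x, x) \<notin> parcs F"
    and F': "\<And>u v. (u, v) \<in> parcs F' \<Longrightarrow> u \<in> pverts F' \<and> v \<in> pverts F'"
    and p: "\<And>u. u \<in> pverts F' \<Longrightarrow> p u \<in> pverts F"
      "inj_on p {u \<in> pverts F'. p u \<noteq> x}"
      "\<And>u v. (u, v) \<in> parcs F' \<Longrightarrow> (p u, p v) \<in> parcs F"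
    using bl by (auto simp: vertex_blowup_def)
  have "\<exists>f. inj_on f (pverts F) \<and> f ` pverts F \<subseteq> S \<and> (\<forall>(u, v)\<in>parcs F. (f u, f v) \<in> parcs G)"
    if "S \<in> ?M" for S
    using that by (fastforce simp: contains_graph_def)
  then obtain f where f: "\<And>S. S \<in> ?M \<Longrightarrow> inj_on (f S) (pverts F)"
      "\<And>S. S \<in> ?M \<Longrightarrow> f S ` pverts F \<subseteq> S"
      "\<And>S u v. S \<in> ?M \<Longrightarrow> (u, v) \<in> parcs F \<Longrightarrow> (f S u, f S v) \<in> parcs G"
    by (metis (no_types, lifting) case_prodD)
  have finM: "finite ?M" by (rule finite_subset[of _ "Pow (pverts G)"]) (use fin in auto)
  have finS: "finite S" if "S \<in> ?M" for S using that fin finite_subset by blast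
  define key where "key S = (S - {f S x}, restrict (f S) ?R)" for S
  have fx: "f S x \<in> S" if "S \<in> ?M" for S using f(2)[OF that] x by blast
  have key: "key \<in> ?M \<rightarrow> K"
  proof
    fix S assume S: "S \<in> ?M"
    have "f S u \<in> S - {f S x}" if "u \<in> ?R" for u
      using that f(1,2)[OF S] x by (auto simp: inj_on_def)
    moreover have "card (S - {f S x}) = m - 1"
      using S fx[OF S] finS[OF S] by (simp add: card_Diff_singleton)
    ultimately show "key S \<in> K" using S by (auto simp: key_def K_def)
  qed
  have finK: "finite K" unfolding K_def
    by (intro finite_SigmaI finite_PiE) (use fin finF in \<open>auto intro: finite_subset\<close>)
  have cK: "card K = (card (pverts G) choose (m - 1)) * (m - 1) ^ card ?R"
  proof -
    have "card K = (\<Sum>T | T \<subseteq> pverts G \<and> card T = m - 1. card (?R \<rightarrow>\<^sub>E T))"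
      unfolding K_def
      by (intro card_SigmaI) (use fin finF in \<open>auto intro!: finite_PiE intro: finite_subset\<close>)
    also have "\<dots> = (\<Sum>T | T \<subseteq> pverts G \<and> card T = m - 1. (m - 1) ^ card ?R)"
      by (intro sum.cong refl) (use finF in \<open>auto simp: card_funcsetE\<close>)
    finally show ?thesis by (simp add: n_subsets[OF fin])
  qed
  have "card ?M > 0" using many by linarith
  then obtain S1 where "S1 \<in> ?M" by (metis (no_types, lifting) card_gt_0_iff ex_in_conv)
  then have "K \<noteq> {}" using funcset_mem[OF key] by blast
  from pigeonhole_card[OF key finM finK this] obtain y
    where y: "card ?M \<le> card (key -` {y} \<inter> ?M) * card K" by blast
  \<comment> \<open>A fibre of at least average size, hence with more members than \<open>F'\<close>
    has vertices.\<close>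
  define Y where "Y = key -` {y} \<inter> ?M"
  have "card (pverts F') * card K < card ?M" using many unfolding cK .
  also have "\<dots> \<le> card Y * card K" using y unfolding Y_def .
  finally have "card (pverts F') * card K < card Y * card K" .
  then have tY: "card (pverts F') < card Y" by simp
  have Y: "S \<in> ?M" "S - {f S x} = fst y" "restrict (f S) ?R = snd y" if "S \<in> Y" for S
    using that by (auto simp: Y_def key_def)
  have inj: "inj_on (\<lambda>S. f S x) Y"
  proof (rule inj_onI)
    fix S S' assume S: "S \<in> Y" "S' \<in> Y" "f S x = f S' x"
    have "S = insert (f S x) (S - {f S x})" using fx[OF Y(1)[OF S(1)]] by blast
    also have "\<dots> = insert (f S' x) (S' - {f S' x})" using Y(2)[OF S(1)] Y(2)[OF S(2)] S(3) by simp
    also have "\<dots> = S'" using fx[OF Y(1)[OF S(2)]] by blast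
    finally show "S = S'" .
  qed
  have finY: "finite Y" using finM by (simp add: Y_def)
  obtain S0 where S0: "S0 \<in> Y" using tY by fastforce
  \<comment> \<open>Each vertex of \<open>F'\<close> gets its own set of the fibre; by
    \<open>inj\<close>, distinct sets give distinct images of \<open>x\<close>.\<close>
  obtain e where e: "e ` pverts F' \<subseteq> Y" "inj_on e (pverts F')"
    using card_le_inj[OF finF(2) finY] tY by auto
  \<comment> \<open>A clone goes to the image of \<open>x\<close> in its own set, any other vertex
    to the image shared by the whole fibre.\<close>
  define h where "h u = (if p u = x then f (e u) x else f S0 (p u))" for u
  have hS: "h u = f S (p u)" if "p u \<noteq> x" "u \<in> pverts F'" "S \<in> Y" for u S
  proof -
    have "p u \<in> ?R" using that p(1) by auto
    then have "f S (p u) = f S0 (p u)"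
      using Y(3)[OF that(3)] Y(3)[OF S0] by (metis restrict_apply')
    then show ?thesis using that by (simp add: h_def)
  qed
  have eY: "e u \<in> Y" if "u \<in> pverts F'" for u using e that by blast
  \<comment> \<open>Non-clones land in the common set \<open>fst y\<close> and clones outside it
    (\<open>hx\<close>), so the two kinds never collide.\<close>
  have hy: "h u \<in> fst y" if "p u \<noteq> x" "u \<in> pverts F'" for u
  proof -
    have "f S0 (p u) \<in> S0 - {f S0 x}"
      using f(1,2)[OF Y(1)[OF S0]] that p(1)[of u] x by (auto simp: inj_on_def)
    then show ?thesis using Y(2)[OF S0] that by (simp add: h_def)
  qed
  have hx: "h u \<notin> fst y" "h u \<in> pverts G" if "p u = x" "u \<in> pverts F'" for u
    using Y(1,2)[OF eY[OF that(2)]] fx[of "e u"] that(1) by (auto simp: h_def)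
  have "inj_on h (pverts F')"
  proof (rule inj_onI)
    fix u v assume uv: "u \<in> pverts F'" "v \<in> pverts F'" "h u = h v"
    consider "p u = x" "p v = x" | "p u = x" "p v \<noteq> x" | "p u \<noteq> x" "p v = x"
      | "p u \<noteq> x" "p v \<noteq> x" by blast
    then show "u = v"
    proof cases
      case 1
      then have "e u = e v" using uv inj eY by (auto simp: h_def inj_on_def)
      then show ?thesis using e uv by (auto simp: inj_on_def)
    next
      case 2 then show ?thesis using hx(1)[of u] hy[of v] uv by auto
    next
      case 3 then show ?thesis using hx(1)[of v] hy[of u] uv by auto
    next
      case 4
      then have "p u = p v"
        using uv f(1)[OF Y(1)[OF S0]] p(1) by (auto simp: h_def inj_on_def)
      then show ?thesis using 4 uv p(2) by (auto simp: inj_on_def)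
    qed
  qed
  moreover have "h ` pverts F' \<subseteq> pverts G"
  proof clarify
    fix u assume "u \<in> pverts F'"
    then show "h u \<in> pverts G"
      using hx(2)[of u] hy[of u] Y(1,2)[OF S0] by (cases "p u = x") auto
  qed
  moreover have "(h u, h v) \<in> parcs G" if a: "(u, v) \<in> parcs F'" for u v
  proof -
    have uv: "u \<in> pverts F'" "v \<in> pverts F'" "(p u, p v) \<in> parcs F" using F' p(3) a by auto
    \<comment> \<open>At most one end of an arc is a clone, so the embedding of that clone's set
      serves both ends.\<close>
    have "\<exists>S\<in>Y. h u = f S (p u) \<and> h v = f S (p v)"
    proof (cases "p u = x")
      case True
      then have "p v \<noteq> x" using uv x by auto
      then have "h v = f (e u) (p v)" using hS uv eY by blast
      then show ?thesis using True uv eY by (auto simp: h_def)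
    next
      case False
      then have "h u = f (e v) (p u)" using hS uv eY by blast
      moreover have "h v = f (e v) (p v)" using hS uv eY by (cases "p v = x") (auto simp: h_def)
      ultimately show ?thesis using uv eY by blast
    qed
    then obtain S where S: "S \<in> Y" "h u = f S (p u)" "h v = f S (p v)" by blast
    show ?thesis unfolding S(2,3) by (rule f(3)[OF Y(1)[OF S(1)] uv(3)])
  qed
  ultimately show ?thesis unfolding contains_graph_def by blast
qed

section \<open>Asymptotic density bounds and supersaturation\<close>

text \<open>Quantifying over graphs instead of bounding \<open>ex_phi\<close> keeps this independent
  of the unspecified \<open>Max {}\<close>.\<close>

definition density_bound :: "nat \<Rightarrow> real \<Rightarrow> 'a pair_pre_digraph \<Rightarrow> bool" where
  "density_bound k c F \<longleftrightarrow>
     (\<forall>\<epsilon>>0. \<forall>\<^sub>F n in sequentially. \<forall>G\<in>free_graphs n F.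
        real (e_phi k G) \<le> (c + \<epsilon>) * real (n choose (k + 1)))"

lemma density_bound_contains:
  assumes "density_bound k c F" and "contains_graph F F'"
  shows "density_bound k c F'"
  unfolding density_bound_def
proof (intro allI impI)
  fix \<epsilon> :: real assume "\<epsilon> > 0"
  then have "\<forall>\<^sub>F n in sequentially. \<forall>G\<in>free_graphs n F.
      real (e_phi k G) \<le> (c + \<epsilon>) * real (n choose (k + 1))"
    using assms(1) unfolding density_bound_def by blast
  then show "\<forall>\<^sub>F n in sequentially. \<forall>G\<in>free_graphs n F'.
      real (e_phi k G) \<le> (c + \<epsilon>) * real (n choose (k + 1))"
  proof eventually_elim
    case (elim n)
    have "free_graphs n F' \<subseteq> free_graphs n F"
      using contains_graph_trans[OF _ assms(2)] by (auto simp: free_graphs_def)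
    with elim show ?case by blast
  qed
qed

text \<open>Excess density forces a positive proportion of \<open>m\<close>-sets to contain
  \<open>F\<close>, whereas in an \<open>F'\<close>-free graph \<open>contains_vertex_blowup\<close>
  allows only a constant times \<open>n choose (m - 1)\<close> of them.\<close>

lemma density_bound_vertex_blowup:
  assumes c: "0 \<le> c" and Q: "density_bound k c F" and bl: "vertex_blowup p x F F'"
  shows "density_bound k c F'"
  unfolding density_bound_def
proof (intro allI impI)
  fix \<epsilon> :: real assume \<epsilon>: "\<epsilon> > 0"
  \<comment> \<open>\<open>m\<close> is fixed before \<open>n\<close>. Half of \<epsilon> is spent
    here; the other half is the excess.\<close>
  have "\<forall>\<^sub>F n in sequentially. (\<forall>G\<in>free_graphs n F.
        real (e_phi k G) \<le> (c + \<epsilon> / 2) * real (n choose (k + 1))) \<and> n \<ge> k + 1"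
    using Q \<epsilon> unfolding density_bound_def
    by (intro eventually_conj eventually_ge_at_top) auto
  then obtain m where m: "\<And>G. G \<in> free_graphs m F \<Longrightarrow>
        real (e_phi k G) \<le> (c + \<epsilon> / 2) * real (m choose (k + 1))" "k + 1 \<le> m"
    by (auto simp: eventually_sequentially)
  \<comment> \<open>\<open>A\<close> is the pigeonhole constant, \<open>B\<close> a trivial bound on
    the stars in an \<open>m\<close>-vertex graph, \<open>D\<close> the excess per
    \<open>m\<close>-set.\<close>
  define A where "A = real (card (pverts F')) * real (m - 1) ^ card (pverts F - {x})"
  define B where "B = real (m * (m choose k))"
  define D where "D = \<epsilon> / 2 * real (m choose (k + 1))"
  have D: "D > 0" using \<epsilon> m(2) by (simp add: D_def zero_less_binomial_iff)
  \<comment> \<open>The threshold comes from the final comparison, where \<open>n - (m - 1)\<close>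
    must outweigh \<open>A * m * B / D\<close>.\<close>
  have "\<forall>\<^sub>F n in sequentially. real n \<ge> real (m - 1) + (A * m * B / D + 1)"
    using filterlim_real_sequentially unfolding filterlim_at_top by blast
  then show "\<forall>\<^sub>F n in sequentially. \<forall>G\<in>free_graphs n F'.
        real (e_phi k G) \<le> (c + \<epsilon>) * real (n choose (k + 1))"
    using eventually_ge_at_top[of m]
  proof eventually_elim
    case (elim n)
    show ?case
    proof (intro ballI leI notI)
      fix G assume G': "G \<in> free_graphs n F'"
        and big: "(c + \<epsilon>) * real (n choose (k + 1)) < real (e_phi k G)"
      have G: "pair_graph G" and n: "card (pverts G) = n" and free: "\<not> contains_graph G F'"
        using G' by (auto simp: free_graphs_def)
      let ?M = "{S. S \<subseteq> pverts G \<and> card S = m}"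
      let ?P = "{S. S \<subseteq> pverts G \<and> card S = m \<and> contains_graph (induced G S) F}"
      have finM: "finite ?M" using pair_graphD(1)[OF G] by auto
      have cM: "card ?M = n choose m" using n_subsets[OF pair_graphD(1)[OF G]] n by simp
      have S: "real (e_phi k (induced G S)) \<le>
          (c + \<epsilon> / 2) * real (m choose (k + 1)) + (if S \<in> ?P then B else 0)" if "S \<in> ?M" for S
      proof (cases "S \<in> ?P")
        case True
        have "e_phi k (induced G S) \<le> m * (m choose k)"
          using e_phi_le_choose[of "induced G S" k] pair_graph_induced[OF G, of S] that by auto
        then have "real (e_phi k (induced G S)) \<le> B" unfolding B_def by (rule of_nat_mono)
        moreover have "0 \<le> (c + \<epsilon> / 2) * real (m choose (k + 1))" using c \<epsilon> by simp
        ultimately show ?thesis using True by simp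
      next
        case False
        then have "induced G S \<in> free_graphs m F"
          using that pair_graph_induced[OF G] by (auto simp: free_graphs_def)
        from m(1)[OF this] show ?thesis by (subst if_not_P[OF False]) simp
      qed
      let ?b = "real (n choose m) * real (m choose (k + 1))"
      let ?q = "real ((n - (k + 1)) choose (m - (k + 1)))"
      have q: "?q > 0" using elim m(2) by (simp add: zero_less_binomial_iff)
      have "(c + \<epsilon>) * ?b = (c + \<epsilon>) * real (n choose (k + 1)) * ?q"
        using arg_cong[OF choose_mult[OF m(2) elim(2)], of real] by simp
      also have "\<dots> < real (e_phi k G) * ?q" using big q by simp
      also have "\<dots> = (\<Sum>S\<in>?M. real (e_phi k (induced G S)))"
        using arg_cong[OF sum_e_phi_induced[OF G m(2)], of real] n by simp
      also have "\<dots> \<le> (\<Sum>S\<in>?M. (c + \<epsilon> / 2) * real (m choose (k + 1)) + (if S \<in> ?P then B else 0))"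
        by (rule sum_mono) (rule S)
      also have "\<dots> = (c + \<epsilon> / 2) * ?b + (\<Sum>S\<in>?M. if S \<in> ?P then B else 0)"
        by (simp add: sum.distrib cM)
      also have "(\<Sum>S\<in>?M. if S \<in> ?P then B else 0) = (\<Sum>S\<in>?M \<inter> ?P. B)"
        by (rule sum.inter_restrict[OF finM, symmetric])
      also have "?M \<inter> ?P = ?P" by auto
      also have "(\<Sum>S\<in>?P. B) = real (card ?P) * B" by simp
      \<comment> \<open>Once the main terms are cancelled, the excess is paid for by the
        \<open>m\<close>-sets containing \<open>F\<close>, at most \<open>B\<close> each.\<close>
      finally have 1: "D * real (n choose m) < real (card ?P) * B"
        by (simp add: D_def algebra_simps)
      have "\<not> card (pverts F') * ((n choose (m - 1)) * (m - 1) ^ card (pverts F - {x})) < card ?P"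
        using contains_vertex_blowup[OF bl pair_graphD(1)[OF G], of m] free m(2) n by auto
      then have "real (card ?P)
          \<le> real (card (pverts F') * ((n choose (m - 1)) * (m - 1) ^ card (pverts F - {x})))"
        by (intro of_nat_mono) simp
      also have "\<dots> = A * real (n choose (m - 1))" by (simp add: A_def)
      finally have "real (card ?P) * B * m \<le> A * real (n choose (m - 1)) * B * m"
        by (intro mult_right_mono) (auto simp: B_def)
      moreover have "D * real (n choose m) * m < real (card ?P) * B * m"
        using 1 m(2) by (intro mult_strict_right_mono) auto
      ultimately have "D * (real (n choose m) * m) < real (n choose (m - 1)) * (A * m * B)"
        by (simp add: algebra_simps)
      moreover have "real (n choose (m - 1)) * (A * m * B) \<le> D * (real (n choose m) * m)"
      proof -
        have "real (n choose (m - 1)) * (A * m * B) = D * (real (n choose (m - 1)) * (A * m * B / D))"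
          using D by simp
        also have "\<dots> \<le> D * (real (n choose (m - 1)) * (real n - real (m - 1)))"
          using elim(1) D by (intro mult_left_mono) auto
        finally show ?thesis using binomial_pred_times[of m n] m(2) by simp
      qed
      ultimately show False by simp
    qed
  qed
qed

section \<open>From a complete graph to a complete multipartite graph\<close>

text \<open>\<open>partial_blowup c H m i\<close> is the complete graph on \<open>m\<close> vertices in which vertex \<open>j < i\<close> is
  replaced by the colour class \<open>j\<close> of \<open>H\<close>.\<close>

definition partial_blowup ::
    "('a \<Rightarrow> nat) \<Rightarrow> 'a pair_pre_digraph \<Rightarrow> nat \<Rightarrow> nat \<Rightarrow> (nat + 'a) pair_pre_digraph" where
  "partial_blowup c H m i =
     (let V = Inl ` {i..<m} \<union> Inr ` {u \<in> pverts H. c u < i}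
      in \<lparr>pverts = V, parcs = {(a, b) \<in> V \<times> V. case_sum id c a \<noteq> case_sum id c b}\<rparr>)"

text \<open>Adjacency at every stage means different colours, where \<open>Inl j\<close> has colour
  \<open>j\<close>. The map preserves colours and is the identity off colour
  \<open>i\<close>.\<close>

lemma vertex_blowup_partial_blowup:
  assumes "finite (pverts H)" "i < m"
  shows "vertex_blowup (\<lambda>a. if case_sum id c a = i then Inl i else a) (Inl i)
           (partial_blowup c H m i) (partial_blowup c H m (Suc i))"
proof -
  define col where "col = case_sum id c"
  define p where "p a = (if col a = i then Inl i else a)" for a
  have V: "pverts (partial_blowup c H m j) = Inl ` {j..<m} \<union> Inr ` {u \<in> pverts H. c u < j}" for j
    by (simp add: partial_blowup_def)
  have E: "(a, b) \<in> parcs (partial_blowup c H m j) \<longleftrightarrow>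
      a \<in> pverts (partial_blowup c H m j) \<and> b \<in> pverts (partial_blowup c H m j) \<and> col a \<noteq> col b" for a b j
    by (simp add: partial_blowup_def Let_def col_def)
  have col_p: "col (p a) = col a" for a by (simp add: p_def col_def)
  have pV: "p a \<in> pverts (partial_blowup c H m i)"
    if "a \<in> pverts (partial_blowup c H m (Suc i))" for a
    using that assms(2) by (cases a) (auto simp: V p_def col_def)
  have "inj_on p {a \<in> pverts (partial_blowup c H m (Suc i)). p a \<noteq> Inl i}"
    by (auto simp: inj_on_def p_def split: if_splits)
  moreover have "finite (pverts (partial_blowup c H m j))" for j using assms(1) by (simp add: V)
  moreover have "Inl i \<in> pverts (partial_blowup c H m i)" using assms(2) by (simp add: V)
  moreover have "parcs (partial_blowup c H m (Suc i))
      \<subseteq> pverts (partial_blowup c H m (Suc i)) \<times> pverts (partial_blowup c H m (Suc i))"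
    using E by auto
  ultimately have "vertex_blowup p (Inl i) (partial_blowup c H m i) (partial_blowup c H m (Suc i))"
    unfolding vertex_blowup_def using pV by (auto simp: E col_p)
  then show ?thesis unfolding p_def col_def .
qed

lemma density_bound_partial_blowup:
  assumes "0 \<le> d" "density_bound k d (complete_graph m)" "finite (pverts H)" "i \<le> m"
  shows "density_bound k d (partial_blowup c H m i)"
  using assms(4)
proof (induction i)
  case 0
  \<comment> \<open>For \<open>i = 0\<close> no vertex of \<open>H\<close> is present, so
    \<open>case_sum id c\<close> just strips \<open>Inl\<close>.\<close>
  have "contains_graph (complete_graph m) (partial_blowup c H m 0)"
    by (rule contains_graphI[of "case_sum id c"])
      (auto simp: partial_blowup_def complete_graph_def inj_on_def)
  then show ?case using density_bound_contains assms(2) by blast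
next
  case (Suc i)
  then show ?case
    using density_bound_vertex_blowup[OF assms(1) _ vertex_blowup_partial_blowup[OF assms(3)]]
    by simp
qed

text \<open>At \<open>i = m\<close> the blow-up is the complete multipartite graph on the colour
  classes of \<open>H\<close>, which contains \<open>H\<close>.\<close>

lemma density_bound_colourable:
  assumes "0 \<le> d" "density_bound k d (complete_graph m)"
    and H: "pair_graph H" and c: "proper_colouring m H c"
  shows "density_bound k d H"
proof -
  have "contains_graph (partial_blowup c H m m) H"
    by (rule contains_graphI[of Inr])
      (use c pair_graphD(2)[OF H] in \<open>auto simp: partial_blowup_def proper_colouring_def\<close>)
  then show ?thesis
    using density_bound_contains density_bound_partial_blowup[OF assms(1,2) pair_graphD(1)[OF H]]
    by blast
qed

section \<open>Degree majorization\<close>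

text \<open>Erdos's argument: colour the neighbourhood of a vertex of maximum degree by induction, and
  give one new colour to the remaining vertices.\<close>

lemma degree_majorization:
  assumes "pair_graph G" "\<not> contains_graph G (complete_graph (Suc r))"
  shows "\<exists>c. c ` pverts G \<subseteq> {..<r} \<and>
           (\<forall>v\<in>pverts G. card {w. (v, w) \<in> parcs G} \<le> card {w \<in> pverts G. c w \<noteq> c v})"
  using assms
proof (induction r arbitrary: G)
  case 0
  have "contains_graph G (complete_graph (Suc 0))" if "v \<in> pverts G" for v
    by (rule contains_graphI[of "\<lambda>_. v"])
      (use that in \<open>auto simp: complete_graph_def inj_on_def\<close>)
  then have "pverts G = {}" using "0.prems"(2) by (metis ex_in_conv)
  then show ?case by simp
next
  case (Suc r)
  note G = pair_graphD[OF Suc.prems(1)]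
  define nb where "nb v = {w. (v, w) \<in> parcs G}" for v
  have finnb: "finite (nb v)" for v using finite_neighbours[OF Suc.prems(1)] by (simp add: nb_def)
  show ?case
  proof (cases "pverts G = {}")
    case False
    then have "Max ((\<lambda>v. card (nb v)) ` pverts G) \<in> (\<lambda>v. card (nb v)) ` pverts G"
      using G(1) by (intro Max_in) auto
    then obtain v where v: "v \<in> pverts G" "card (nb v) = Max ((\<lambda>v. card (nb v)) ` pverts G)"
      by auto
    have max: "card (nb w) \<le> card (nb v)" if "w \<in> pverts G" for w
      using v(2) G(1) that by simp
    have sub: "nb v \<subseteq> pverts G" using G(2) by (auto simp: nb_def)
    \<comment> \<open>A clique inside the neighbourhood of \<open>v\<close> would be extended by
      \<open>v\<close> itself.\<close>
    have "\<not> contains_graph (induced G (nb v)) (complete_graph (Suc r))"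
    proof
      assume "contains_graph (induced G (nb v)) (complete_graph (Suc r))"
      then obtain f where f: "inj_on f {..<Suc r}" "f ` {..<Suc r} \<subseteq> nb v"
          "\<And>i j. i < Suc r \<Longrightarrow> j < Suc r \<Longrightarrow> i \<noteq> j \<Longrightarrow> (f i, f j) \<in> parcs G"
        by (auto elim!: contains_graphE simp: complete_graph_def)
      have fv: "(v, f i) \<in> parcs G" if "i < Suc r" for i using f(2) that by (auto simp: nb_def)
      have "contains_graph G (complete_graph (Suc (Suc r)))"
      proof (rule contains_graphI[of "f(Suc r := v)"])
        have "v \<notin> f ` {..<Suc r}" using f(2) G(4) by (auto simp: nb_def)
        then show "inj_on (f(Suc r := v)) (pverts (complete_graph (Suc (Suc r))))"
          using f(1) by (simp add: complete_graph_def lessThan_Suc[of "Suc r"] inj_on_fun_updI)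
        show "f(Suc r := v) ` pverts (complete_graph (Suc (Suc r))) \<subseteq> pverts G"
          using f(2) sub v(1) by (force simp: complete_graph_def less_Suc_eq image_subset_iff)
        show "((f(Suc r := v)) i, (f(Suc r := v)) j) \<in> parcs G"
          if "(i, j) \<in> parcs (complete_graph (Suc (Suc r)))" for i j
          using that f(3) fv fv[THEN G(3)]
          by (cases "i = Suc r"; cases "j = Suc r") (auto simp: complete_graph_def less_Suc_eq)
      qed
      then show False using Suc.prems(2) by blast
    qed
    from Suc.IH[OF pair_graph_induced[OF Suc.prems(1) sub] this] obtain c where
      c: "c ` nb v \<subseteq> {..<r}" and
      maj: "\<And>w. w \<in> nb v \<Longrightarrow>
        card {u. (w, u) \<in> parcs (induced G (nb v))} \<le> card {u \<in> nb v. c u \<noteq> c w}"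
      by (auto simp del: induced_simps(2))
    define c' where "c' w = (if w \<in> nb v then c w else r)" for w
    have "card (nb w) \<le> card {u \<in> pverts G. c' u \<noteq> c' w}" if w: "w \<in> pverts G" for w
    proof (cases "w \<in> nb v")
      case True
      let ?I = "{u. (w, u) \<in> parcs (induced G (nb v))}"
      let ?D = "{u \<in> nb v. c u \<noteq> c w}"
      have "finite ?I" by (rule finite_subset[OF _ finnb[of v]]) auto
      \<comment> \<open>Induction handles the neighbours of \<open>w\<close> inside
        \<open>nb v\<close>; everything outside has colour \<open>r\<close>, unlike
        \<open>w\<close>.\<close>
      then have "card (nb w) \<le> card (?I \<union> (pverts G - nb v))"
        using G(1,2) True by (intro card_mono) (auto simp: nb_def)
      also have "\<dots> \<le> card ?I + card (pverts G - nb v)" by (rule card_Un_le)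
      also have "\<dots> \<le> card ?D + card (pverts G - nb v)" using maj[OF True] by simp
      also have "\<dots> = card (?D \<union> (pverts G - nb v))"
        using finnb G(1) by (intro card_Un_disjoint[symmetric]) auto
      also have "\<dots> \<le> card {u \<in> pverts G. c' u \<noteq> c' w}"
        using G(1) sub True c by (intro card_mono) (auto simp: c'_def)
      finally show ?thesis .
    next
      case False
      \<comment> \<open>Here \<open>w\<close> has colour \<open>r\<close> and so differs from all of
        \<open>nb v\<close>, whose size is the maximum degree.\<close>
      have "card (nb w) \<le> card (nb v)" by (rule max[OF w])
      also have "\<dots> \<le> card {u \<in> pverts G. c' u \<noteq> c' w}"
        using G(1) sub False c by (intro card_mono) (auto simp: c'_def)
      finally show ?thesis .
    qed
    moreover have "c' ` pverts G \<subseteq> {..<Suc r}" using c by (auto simp: c'_def less_Suc_eq)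
    ultimately show ?thesis unfolding nb_def by blast
  qed simp
qed

section \<open>Lower bound for \<open>ex_phi k n H\<close>\<close>

text \<open>Majorization turns an extremal graph into a complete multipartite graph \<open>T\<close>
  with at least as many stars. An embedding of \<open>H\<close> into \<open>T\<close>, followed by
  \<open>c\<close>, would colour \<open>H\<close> with \<open>r\<close> colours.\<close>

lemma ex_phi_complete_le:
  assumes r: "1 \<le> r" and H: "\<And>c. \<not> proper_colouring r H c" "pair_graph H"
  shows "ex_phi k n (complete_graph (r + 1)) \<le> ex_phi k n H"
proof -
  have "(0, 1) \<in> parcs (complete_graph (r + 1))" using r by (simp add: complete_graph_def)
  then have "parcs (complete_graph (r + 1)) \<noteq> {}" by blast
  then have "ex_phi k n (complete_graph (r + 1)) \<in> e_phi k ` free_graphs n (complete_graph (r + 1))"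
    unfolding ex_phi_def
    by (intro Max_in finite_e_phi_free_graphs) (simp add: free_graphs_nonempty)
  then obtain G where ex: "ex_phi k n (complete_graph (r + 1)) = e_phi k G"
      and free: "G \<in> free_graphs n (complete_graph (r + 1))"
    by (elim imageE)
  then have G: "pair_graph G" "card (pverts G) = n" "\<not> contains_graph G (complete_graph (Suc r))"
    by (auto simp: free_graphs_def)
  obtain c where c: "c ` pverts G \<subseteq> {..<r}"
      "\<And>v. v \<in> pverts G \<Longrightarrow> card {w. (v, w) \<in> parcs G} \<le> card {w \<in> pverts G. c w \<noteq> c v}"
    using degree_majorization[OF G(1,3)] by blast
  define T where "T = \<lparr>pverts = pverts G, parcs = {(v, w) \<in> pverts G \<times> pverts G. c w \<noteq> c v}\<rparr>"
  have T: "pverts T = pverts G" "parcs T = {(v, w) \<in> pverts G \<times> pverts G. c w \<noteq> c v}"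
    by (auto simp: T_def)
  have "pair_graph T" using pair_graphD(1)[OF G(1)] by (intro pair_graphI) (auto simp: T)
  moreover have "\<not> contains_graph T H"
  proof
    assume "contains_graph T H"
    then obtain f where f: "f ` pverts H \<subseteq> pverts T"
        "\<And>u v. (u, v) \<in> parcs H \<Longrightarrow> (f u, f v) \<in> parcs T"
      by (rule contains_graphE) blast
    then have "proper_colouring r H (c \<circ> f)"
      unfolding proper_colouring_def using c(1) T by fastforce
    then show False using H by blast
  qed
  ultimately have "T \<in> free_graphs n H" using G(2) by (simp add: free_graphs_def T)
  then have "e_phi k T \<le> ex_phi k n H" by (rule e_phi_le_ex_phi)
  moreover have "e_phi k G \<le> e_phi k T"
    unfolding e_phi_def T(1) out_degree_pair
    by (intro sum_mono binomial_right_mono) (use c(2) in \<open>simp add: T(2)\<close>)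
  ultimately show ?thesis using ex by simp
qed

section \<open>Limit density and the final estimate\<close>

text \<open>One \<open>m\<close> with density near the infimum bounds all \<open>n \<ge> m\<close>.
  The index starts at \<open>k + 1\<close> because below it the denominator is 0 and the quotient
  would default to 0.\<close>

lemma density_bound_Inf:
  fixes k :: nat and F :: "'a pair_pre_digraph"
  defines "d \<equiv> \<lambda>m. real (ex_phi k m F) / real (m choose (k + 1))"
  shows "density_bound k (INF m\<in>{k + 1..}. d m) F"
  unfolding density_bound_def
proof (intro allI impI)
  fix \<epsilon> :: real assume "\<epsilon> > 0"
  then have "\<exists>x\<in>d ` {k + 1..}. x < (INF m\<in>{k + 1..}. d m) + \<epsilon>"
    by (intro cInf_lessD) auto
  then obtain m where m: "k + 1 \<le> m" "d m < (INF m\<in>{k + 1..}. d m) + \<epsilon>" by auto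
  show "\<forall>\<^sub>F n in sequentially. \<forall>G\<in>free_graphs n F.
          real (e_phi k G) \<le> ((INF m\<in>{k + 1..}. d m) + \<epsilon>) * real (n choose (k + 1))"
    using eventually_ge_at_top[of m]
  proof eventually_elim
    case (elim n)
    show ?case
    proof
      fix G assume "G \<in> free_graphs n F"
      from e_phi_le_density[OF this m(1) elim]
      have "real (e_phi k G) \<le> d m * real (n choose (k + 1))" by (simp add: d_def)
      also have "\<dots> \<le> ((INF m\<in>{k + 1..}. d m) + \<epsilon>) * real (n choose (k + 1))"
        using m(2) by (intro mult_right_mono) auto
      finally show "real (e_phi k G)
          \<le> ((INF m\<in>{k + 1..}. d m) + \<epsilon>) * real (n choose (k + 1))" .
    qed
  qed
qed

theorem theorem3:
  fixes r k :: nat and H :: "'a pair_pre_digraph"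
  assumes "r \<ge> 2" and "k \<ge> 1"
    and "pair_graph H" and "chromatic_number H = r + 1"
  shows "(\<lambda>n. real (ex_phi k n H) - real (ex_phi k n (complete_graph (r + 1))))
           \<in> o(\<lambda>n. real n ^ (k + 1))"
proof (rule landau_o.smallI)
  let ?K = "complete_graph (r + 1)"
  fix \<epsilon> :: real assume \<epsilon>: "\<epsilon> > 0"
  note H = pair_graphD[OF assms(3)]
  \<comment> \<open>An injective numbering is a proper colouring, so the minimum defining
    \<open>chromatic_number\<close> is attained.\<close>
  obtain g :: "'a \<Rightarrow> nat" where g: "inj_on g (pverts H)"
    using finite_imp_inj_to_nat_seg[OF H(1)] by blast
  have "finite (g ` pverts H)" using H(1) by simp
  then obtain m where "g ` pverts H \<subseteq> {..<m}" using finite_nat_iff_bounded by blast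
  moreover have "g u \<noteq> g v" if "(u, v) \<in> parcs H" for u v
    using that g H(2,4) by (auto simp: inj_on_def)
  ultimately have "proper_colouring m H g" by (auto simp: proper_colouring_def)
  then have "\<exists>m c. proper_colouring m H c" by blast
  then have "\<exists>c. proper_colouring (chromatic_number H) H c"
    unfolding chromatic_number_def by (rule LeastI_ex)
  then obtain c where c: "proper_colouring (r + 1) H c" using assms(4) by auto
  have less: "\<not> proper_colouring m H c" if "m < r + 1" for m c
    using not_less_Least[of m "\<lambda>m. \<exists>c. proper_colouring m H c"] that assms(4)
    by (auto simp: chromatic_number_def)
  \<comment> \<open>An edgeless \<open>H\<close> would be 1-colourable. Having an edge makes
    \<open>free_graphs n H\<close> nonempty, so \<open>Max\<close> is attained.\<close>
  have "parcs H \<noteq> {}"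
    using less[of 1 "\<lambda>_. 0"] assms(1) by (auto simp: proper_colouring_def)
  then have max: "ex_phi k n H \<in> e_phi k ` free_graphs n H" for n
    unfolding ex_phi_def by (intro Max_in finite_e_phi_free_graphs) (simp add: free_graphs_nonempty)
  define d where "d m = real (ex_phi k m ?K) / real (m choose (k + 1))" for m
  define D where "D = (INF m\<in>{k + 1..}. d m)"
  have D0: "0 \<le> D" unfolding D_def by (rule cINF_greatest) (auto simp: d_def)
  have Dle: "D \<le> d n" if "k + 1 \<le> n" for n
    unfolding D_def by (rule cINF_lower) (use that in \<open>auto simp: d_def intro!: bdd_belowI[of _ 0]\<close>)
  have "density_bound k D ?K" unfolding D_def d_def by (rule density_bound_Inf)
  then have "density_bound k D H" by (rule density_bound_colourable[OF D0 _ assms(3) c])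
  then have "\<forall>\<^sub>F n in sequentially. \<forall>G\<in>free_graphs n H.
      real (e_phi k G) \<le> (D + \<epsilon>) * real (n choose (k + 1))"
    using \<epsilon> by (simp add: density_bound_def)
  then show "\<forall>\<^sub>F n in sequentially. norm (real (ex_phi k n H) - real (ex_phi k n ?K))
      \<le> \<epsilon> * norm (real n ^ (k + 1))"
    using eventually_ge_at_top[of "k + 1"]
  proof eventually_elim
    case (elim n)
    have "real (ex_phi k n H) \<le> (D + \<epsilon>) * real (n choose (k + 1))"
      using elim(1) max[of n] by auto
    \<comment> \<open>Passing from the infimum to the density at this same \<open>n\<close> recovers
      \<open>ex_phi k n ?K\<close> itself.\<close>
    also have "\<dots> \<le> (d n + \<epsilon>) * real (n choose (k + 1))"
      using Dle[OF elim(2)] by (intro mult_right_mono) auto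
    also have "\<dots> = real (ex_phi k n ?K) + \<epsilon> * real (n choose (k + 1))"
      using elim(2) by (simp add: d_def field_simps zero_less_binomial_iff)
    also have "real (n choose (k + 1)) \<le> real (n ^ (k + 1))"
      using binomial_le_pow[OF elim(2)] by (rule of_nat_mono)
    finally have "real (ex_phi k n H) \<le> real (ex_phi k n ?K) + \<epsilon> * real n ^ (k + 1)"
      using \<epsilon> by simp
    \<comment> \<open>The difference is nonnegative, so the upper bound alone controls the
      norm.\<close>
    moreover have "ex_phi k n ?K \<le> ex_phi k n H"
      using less assms(1,3) by (intro ex_phi_complete_le) auto
    ultimately show ?case by simp
  qed
qed

end
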